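(* Let $k$ be a field. For each $j\in\mathbb N\setminus\{0\}$, the toric Hilbert scheme $H_{A(j)}$ of the matrix $$A(j)=\begin{pmatrix}1&1&1&1&1\\0&1&3+3j&4+3j&6+3j\end{pmatrix}$$ has an irreducible component of dimension at least $j$.
   Context: Let $A=[a_1\cdots a_n]\in\mathbb Z^{d\times n}$ have rank $d$ with $\ker(A)\cap\mathbb N^n=\{0\}$, where $\mathbb N$ contains $0$, and $\mathbb N A=\{\sum m_ia_i: m_i\in\mathbb N\}$. The ring $S=k[x_1,\dots,x_n]$ is $\mathbb Z^d$-graded by $\deg x_i=a_i$; homogeneous for this grading is called $A$-homogeneous. An $A$-homogeneous ideal $I\subseteq S$ is $A$-graded if $\dim_k(S/I)_b=1$ for $b\in\mathbb N A$ and $0$ otherwise. It is weakly $A$-graded if $\dim_k (S/I)_b\in\{0,1\}$ for all $b\in\mathbb Z^d$, with value $1$ only if $b\in\mathbb N A$. Graver basis: for $u,v\in\mathbb N^n$ write $u<v$ if $u_i\le v_i$ for all $i$ and $u\ne v$. A binomial $x^u-x^v$ ($u\neq v$) with $Au=Av$ is a Graver binomial if there are no nonzero $u',v'\in\mathbb N^n$ with $Au'=Av'$, $u'<u$, $v'<v$. Toric Hilbert scheme $H_A$: A Graver degree is an element $A\alpha\in\mathbb N A$ for a Graver binomial $x^\alpha-x^\beta$. Let $b_1,\dots,b_N$ be the Graver degrees, $m_i$ the number of monomials of degree $b_i$, and $X=\mathbb P^{m_1-1}\times\cdots\times\mathbb P^{m_N-1}$ over $k$, where $\mathbb P^{m_i-1}$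 has homogeneous coordinates $\xi_u$ ($u\in\mathbb N^n$, $Au=b_i$). To $p\in X$ associate the ideal $I_p$ generated by all $\xi_vx^u-\xi_ux^v$, with $x^u,x^v$ of the same Graver degree (coordinates evaluated at $p$); it is weakly $A$-graded. Let $B\subset\mathbb N A$ be a finite set of degrees such that every weakly $A$-graded ideal generated in Graver degrees whose quotient has dimension $1$ in every degree of $B$ is $A$-graded (such $B$ exists). For $b\in B$ let $M_b$ be the matrix whose $d_b$ rows are indexed by the monomials of degree $b$ and which has, for each pair $x^\alpha,x^\beta$ of distinct monomials of the same Graver degree and each $\gamma\in\mathbb N^n$ such that $v=\gamma+\alpha$ and $u=\gamma+\beta$ satisfy $Au=Av=b$, a column with entry $\xi_\alpha$ in row $x^u$, $-\xi_\beta$ in row $x^v$, and $0$ elsewhere. $H_A\subseteq X$ is the closed subscheme defined by the vanishing of all $d_b\times d_b$ minors of all $M_b$, $b\in B$. Its points $p$ correspond bijectively to the $A$-graded ideals $I_p$. *)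

theory Defs
  imports
    "HOL-Analysis.Analysis"
    "HOL-Library.Poly_Mapping"
    "HOL-Library.Extended_Nat"
    "HOL-Algebra.Embedded_Algebras"
    "HOL-Algebra.QuotRing"
    "HOL-Algebra.Algebraic_Closure_Type"
    "Jordan_Normal_Form.Determinant"
begin

no_notation Matrix.vec_index (infixl "$" 100)

subsection \<open>The \<open>A\<close>-grading\<close>

text \<open>
  The monomial with exponent vector \<open>u\<close> is represented by \<open>u\<close> itself, of type \<open>nat ^ 'n\<close>; the ring
  \<open>S = k[x\<^sub>1, \<dots>, x\<^sub>n]\<close> is the monoid algebra of \<open>nat ^ 'n\<close>, i.e. the type \<open>nat ^ 'n \<Rightarrow>\<^sub>0 'k\<close>.
\<close>

definition adeg :: "int ^ 'n ^ 'd \<Rightarrow> nat ^ 'n \<Rightarrow> int ^ 'd" where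
  "adeg A u = A *v (\<chi> i. int (u $ i))"

definition semigroup_NA :: "int ^ 'n ^ 'd \<Rightarrow> (int ^ 'd) set" where
  "semigroup_NA A = range (adeg A)"

text \<open>
  Gradings of \<open>'m \<Rightarrow>\<^sub>0 'k\<close> are given by a degree function on the monomials. The same notions serve
  the \<open>A\<close>-grading of \<open>S\<close> and the multigrading of the coordinate ring of \<open>X\<close> below.
\<close>

definition graded_piece :: "('m \<Rightarrow> 'e) \<Rightarrow> 'e \<Rightarrow> ('m \<Rightarrow>\<^sub>0 'k::zero) set" where
  "graded_piece gdeg e = {f. \<forall>m \<in> Poly_Mapping.keys f. gdeg m = e}"

definition graded_component :: "('m \<Rightarrow> 'e) \<Rightarrow> 'e \<Rightarrow> ('m \<Rightarrow>\<^sub>0 'k::comm_monoid_add) \<Rightarrow> ('m \<Rightarrow>\<^sub>0 'k)" where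
  "graded_component gdeg e f =
     (\<Sum>m | m \<in> Poly_Mapping.keys f \<and> gdeg m = e. Poly_Mapping.single m (Poly_Mapping.lookup f m))"

definition homogeneous_set :: "('m \<Rightarrow> 'e) \<Rightarrow> ('m \<Rightarrow>\<^sub>0 'k::comm_monoid_add) set \<Rightarrow> bool" where
  "homogeneous_set gdeg I \<longleftrightarrow> (\<forall>f \<in> I. \<forall>e. graded_component gdeg e f \<in> I)"

abbreviation S_ring :: "(nat ^ 'n \<Rightarrow>\<^sub>0 'k::field) ring" where
  "S_ring \<equiv> ring_of_type_algebra"

text \<open>
  \<open>quotient_dim A I b m\<close> says \<open>dim\<^sub>k (S/I)\<^sub>b = m\<close>: the dimension is taken over the image of \<open>k\<close> in \<open>S/I\<close>,
  and \<open>(S/I)\<^sub>b\<close> is the image of \<open>S\<^sub>b\<close>. For \<open>I = S\<close> only \<open>m = 0\<close> is possible.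
\<close>

definition quotient_dim ::
  "int ^ 'n ^ 'd \<Rightarrow> (nat ^ 'n \<Rightarrow>\<^sub>0 'k::field) set \<Rightarrow> int ^ 'd \<Rightarrow> nat \<Rightarrow> bool" where
  "quotient_dim A I b m \<longleftrightarrow>
     ring.dimension (S_ring Quot I) m
       (range (\<lambda>c. I +>\<^bsub>S_ring\<^esub> Poly_Mapping.single 0 c))
       ((\<lambda>f. I +>\<^bsub>S_ring\<^esub> f) ` graded_piece (adeg A) b)"

definition A_homogeneous_ideal :: "int ^ 'n ^ 'd \<Rightarrow> (nat ^ 'n \<Rightarrow>\<^sub>0 'k::field) set \<Rightarrow> bool" where
  "A_homogeneous_ideal A I \<longleftrightarrow> ideal I S_ring \<and> homogeneous_set (adeg A) I"

definition A_graded :: "int ^ 'n ^ 'd \<Rightarrow> (nat ^ 'n \<Rightarrow>\<^sub>0 'k::field) set \<Rightarrow> bool" where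
  "A_graded A I \<longleftrightarrow> A_homogeneous_ideal A I \<and>
     (\<forall>b. quotient_dim A I b (if b \<in> semigroup_NA A then 1 else 0))"

definition weakly_A_graded :: "int ^ 'n ^ 'd \<Rightarrow> (nat ^ 'n \<Rightarrow>\<^sub>0 'k::field) set \<Rightarrow> bool" where
  "weakly_A_graded A I \<longleftrightarrow> A_homogeneous_ideal A I \<and>
     (\<forall>b. quotient_dim A I b 0 \<or> quotient_dim A I b 1 \<and> b \<in> semigroup_NA A)"

subsection \<open>Graver degrees\<close>

text \<open>The order on \<open>nat ^ 'n\<close> is the componentwise one.\<close>

definition graver_binomial :: "int ^ 'n ^ 'd \<Rightarrow> nat ^ 'n \<Rightarrow> nat ^ 'n \<Rightarrow> bool" where
  "graver_binomial A u v \<longleftrightarrow> u \<noteq> v \<and> adeg A u = adeg A v \<and>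
     \<not> (\<exists>u' v'. u' \<noteq> 0 \<and> v' \<noteq> 0 \<and> adeg A u' = adeg A v' \<and> u' < u \<and> v' < v)"

definition graver_degrees :: "int ^ 'n ^ 'd \<Rightarrow> (int ^ 'd) set" where
  "graver_degrees A = {adeg A \<alpha> | \<alpha> \<beta>. graver_binomial A \<alpha> \<beta>}"

definition generated_in_graver_degrees :: "int ^ 'n ^ 'd \<Rightarrow> (nat ^ 'n \<Rightarrow>\<^sub>0 'k::field) set \<Rightarrow> bool" where
  "generated_in_graver_degrees A I \<longleftrightarrow>
     (\<exists>G \<subseteq> (\<Union>b \<in> graver_degrees A. graded_piece (adeg A) b). I = Idl\<^bsub>S_ring\<^esub> G)"

text \<open>The finite sets \<open>B\<close> of degrees allowed in the construction of the toric Hilbert scheme over \<open>'k\<close>.\<close>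

definition hilbert_test_degrees :: "'k::field itself \<Rightarrow> int ^ 'n ^ 'd \<Rightarrow> (int ^ 'd) set \<Rightarrow> bool" where
  "hilbert_test_degrees _ A B \<longleftrightarrow> finite B \<and> B \<subseteq> semigroup_NA A \<and>
     (\<forall>I :: (nat ^ 'n \<Rightarrow>\<^sub>0 'k) set.
        weakly_A_graded A I \<and> generated_in_graver_degrees A I \<and> (\<forall>b \<in> B. quotient_dim A I b 1)
        \<longrightarrow> A_graded A I)"

subsection \<open>The product \<open>X\<close> of projective spaces\<close>

text \<open>
  The multihomogeneous coordinate ring of \<open>X\<close> is \<open>k[\<xi>\<^sub>u : A u a Graver degree]\<close>, a subring of the
  polynomial ring \<open>(nat ^ 'n \<Rightarrow>\<^sub>0 nat) \<Rightarrow>\<^sub>0 'k\<close> in variables \<open>\<xi>\<^sub>u\<close> indexed by all \<open>u\<close>.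
\<close>

definition xi :: "nat ^ 'n \<Rightarrow> (nat ^ 'n \<Rightarrow>\<^sub>0 nat) \<Rightarrow>\<^sub>0 'k::field" where
  "xi u = Poly_Mapping.single (Poly_Mapping.single u 1) 1"

definition X_ring :: "int ^ 'n ^ 'd \<Rightarrow> ((nat ^ 'n \<Rightarrow>\<^sub>0 nat) \<Rightarrow>\<^sub>0 'k::field) ring" where
  "X_ring A = ring_of_type_algebra
     \<lparr>carrier := {f. \<forall>m \<in> Poly_Mapping.keys f. \<forall>u \<in> Poly_Mapping.keys m. adeg A u \<in> graver_degrees A}\<rparr>"

text \<open>The \<open>b\<close>-th entry of the multidegree is the total degree in the variables \<open>\<xi>\<^sub>u\<close> with \<open>A u = b\<close>.\<close>

definition multidegree :: "int ^ 'n ^ 'd \<Rightarrow> (nat ^ 'n \<Rightarrow>\<^sub>0 nat) \<Rightarrow> int ^ 'd \<Rightarrow> nat" where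
  "multidegree A m = (\<lambda>b. \<Sum>u | u \<in> Poly_Mapping.keys m \<and> adeg A u = b. Poly_Mapping.lookup m u)"

text \<open>
  The points of the scheme \<open>X\<close> (not only the closed or \<open>k\<close>-rational ones) are the multihomogeneous
  prime ideals of its coordinate ring that contain none of the irrelevant ideals
  \<open>(\<xi>\<^sub>u : A u = b)\<close>, \<open>b\<close> a Graver degree: on the chart where one variable of each block is inverted,
  these primes correspond to the primes of the multidegree-zero part of the localization.
\<close>

definition X_points :: "int ^ 'n ^ 'd \<Rightarrow> ((nat ^ 'n \<Rightarrow>\<^sub>0 nat) \<Rightarrow>\<^sub>0 'k::field) set set" where
  "X_points A = {P. primeideal P (X_ring A) \<and> homogeneous_set (multidegree A) P \<and>
     (\<forall>b \<in> graver_degrees A. \<exists>u. adeg A u = b \<and> xi u \<notin> P)}"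

text \<open>
  The Zariski topology, given by its basis of open sets \<open>{P. f \<notin> P}\<close>. As points are multihomogeneous,
  such a set for arbitrary \<open>f\<close> is the union of those for the multihomogeneous components of \<open>f\<close>.
\<close>

definition X_zariski :: "int ^ 'n ^ 'd \<Rightarrow> ((nat ^ 'n \<Rightarrow>\<^sub>0 nat) \<Rightarrow>\<^sub>0 'k::field) set topology" where
  "X_zariski A = topology_generated_by {{P \<in> X_points A. f \<notin> P} | f. f \<in> carrier (X_ring A)}"

subsection \<open>The toric Hilbert scheme\<close>

text \<open>The rows of \<open>M\<^sub>b\<close> are indexed by monomials, the columns by triples \<open>(\<alpha>, \<beta>, \<gamma>)\<close>.\<close>

definition M_rows :: "int ^ 'n ^ 'd \<Rightarrow> int ^ 'd \<Rightarrow> (nat ^ 'n) set" where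
  "M_rows A b = {w. adeg A w = b}"

definition M_columns ::
  "int ^ 'n ^ 'd \<Rightarrow> int ^ 'd \<Rightarrow> ((nat ^ 'n) \<times> (nat ^ 'n) \<times> (nat ^ 'n)) set" where
  "M_columns A b = {(\<alpha>, \<beta>, \<gamma>). \<alpha> \<noteq> \<beta> \<and> adeg A \<alpha> = adeg A \<beta> \<and> adeg A \<alpha> \<in> graver_degrees A \<and>
     adeg A (\<gamma> + \<alpha>) = b \<and> adeg A (\<gamma> + \<beta>) = b}"

definition M_entry ::
  "nat ^ 'n \<Rightarrow> (nat ^ 'n) \<times> (nat ^ 'n) \<times> (nat ^ 'n) \<Rightarrow> (nat ^ 'n \<Rightarrow>\<^sub>0 nat) \<Rightarrow>\<^sub>0 'k::field" where
  "M_entry w = (\<lambda>(\<alpha>, \<beta>, \<gamma>).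
     if w = \<gamma> + \<beta> then xi \<alpha> else if w = \<gamma> + \<alpha> then - xi \<beta> else 0)"

text \<open>
  The maximal minors: \<open>rs\<close> enumerates all rows and \<open>cs\<close> lists as many distinct columns. Reordering
  either list changes the determinant only by a sign.
\<close>

definition maximal_minors ::
  "int ^ 'n ^ 'd \<Rightarrow> int ^ 'd \<Rightarrow> ((nat ^ 'n \<Rightarrow>\<^sub>0 nat) \<Rightarrow>\<^sub>0 'k::field) set" where
  "maximal_minors A b =
     {Determinant.det (Matrix.mat (length rs) (length rs) (\<lambda>(i, j). M_entry (rs ! i) (cs ! j))) | rs cs.
        distinct rs \<and> set rs = M_rows A b \<and>
        distinct cs \<and> set cs \<subseteq> M_columns A b \<and> length cs = length rs}"

text \<open>
  The underlying topological space of \<open>H\<^sub>A\<close>, a closed subspace of that of \<open>X\<close>. Irreducible components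
  and dimension of a scheme depend on nothing else.
\<close>

definition toric_hilbert_scheme ::
  "'k::field itself \<Rightarrow> int ^ 'n ^ 'd \<Rightarrow> (int ^ 'd) set \<Rightarrow> ((nat ^ 'n \<Rightarrow>\<^sub>0 nat) \<Rightarrow>\<^sub>0 'k) set topology" where
  "toric_hilbert_scheme _ A B =
     subtopology (X_zariski A) {P \<in> X_points A. \<forall>b \<in> B. maximal_minors A b \<subseteq> P}"

subsection \<open>Irreducible components and dimension\<close>

definition irreducible_in :: "'a topology \<Rightarrow> 'a set \<Rightarrow> bool" where
  "irreducible_in T Z \<longleftrightarrow> Z \<subseteq> topspace T \<and> Z \<noteq> {} \<and>
     (\<forall>C D. closedin T C \<and> closedin T D \<and> Z \<subseteq> C \<union> D \<longrightarrow> Z \<subseteq> C \<or> Z \<subseteq> D)"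

definition irreducible_components_of :: "'a topology \<Rightarrow> 'a set set" where
  "irreducible_components_of T =
     {Z. irreducible_in T Z \<and> (\<forall>Y. irreducible_in T Y \<and> Z \<subseteq> Y \<longrightarrow> Y = Z)}"

text \<open>The empty space gets dimension \<open>0\<close> here; irreducible components are never empty.\<close>

definition krull_dim :: "'a topology \<Rightarrow> enat" where
  "krull_dim T = Sup {enat n | n. \<exists>Z :: nat \<Rightarrow> 'a set.
     (\<forall>i \<le> n. closedin T (Z i) \<and> irreducible_in T (Z i)) \<and> (\<forall>i < n. Z i \<subset> Z (Suc i))}"

subsection \<open>The matrices \<open>A(j)\<close>\<close>

definition A_mat :: "nat \<Rightarrow> int ^ 5 ^ 2" where
  "A_mat j = vector [vector [1, 1, 1, 1, 1],
                     vector [0, 1, 3 + 3 * int j, 4 + 3 * int j, 6 + 3 * int j]]"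

text \<open>In the index type \<open>5\<close> the last index is \<open>5 = 0\<close>.\<close>

lemma A_mat_entries:
  "A_mat j $ 1 $ i = 1"
  "A_mat j $ 2 $ 1 = 0" "A_mat j $ 2 $ 2 = 1" "A_mat j $ 2 $ 3 = 3 + 3 * int j"
  "A_mat j $ 2 $ 4 = 4 + 3 * int j" "A_mat j $ 2 $ 5 = 6 + 3 * int j"
proof -
  have "i = 1 \<or> i = 2 \<or> i = 3 \<or> i = 4 \<or> i = 5"
  proof (cases i)
    case (of_int z)
    then have "z = 0 \<or> z = 1 \<or> z = 2 \<or> z = 3 \<or> z = 4" by auto
    then show ?thesis using of_int by auto
  qed
  then show "A_mat j $ 1 $ i = 1"
    unfolding A_mat_def by (auto simp: vector_def)
qed (simp_all add: A_mat_def vector_def)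

lemma A_mat_kernel:
  assumes "adeg (A_mat j) u = 0"
  shows "u = 0"
proof -
  have "adeg (A_mat j) u $ 1 = (\<Sum>i\<in>UNIV. int (u $ i))"
    by (simp add: adeg_def matrix_vector_mult_def A_mat_entries)
  then have "(\<Sum>i\<in>UNIV. int (u $ i)) = 0" using assms by simp
  then have "\<forall>i. int (u $ i) = 0" by (subst (asm) sum_nonneg_eq_0_iff) auto
  then show ?thesis by (simp add: Finite_Cartesian_Product.vec_eq_iff)
qed

end

(*
A chain of j + 1 points of the scheme is produced from a j-parameter family of A(j)-graded ideals.
  Call a monomial reduced if its x_4-exponent is maximal in its degree, and let a(w) = 0 if x^w is
  not reduced, a(w) = t_i if x^w is reduced and equals x_1^e x_2^(3+3i) x_4^k x_5^(j-i) with
  e <= 1 and i < j, and a(w) = 1 otherwise. The reduced monomials are restricted enough that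
  a(u) a(g+v) = a(v) a(g+u) whenever x^u, x^v have the same degree, so the binomials
  a(v) x^u - a(u) x^v span an A(j)-graded ideal over k[t_0, ..., t_(j-1)]. For the scheme H_A this
  says that (a(w))_w is a nonzero left null vector of every M_b under xi_u |-> a(u), which kills all
  maximal minors. The parameter t_i is visible in a Graver degree, because
  x_1^(2+3i) x_3^(j+1-i) - x_2^(3+3i) x_5^(j-i) is a Graver binomial with reduced terms. Hence the
  kernels of xi_u |-> a(u), with t_0, ..., t_(n-1) specialized to 1, strictly increase for n = 0, ..., j.
*)
theory Submission
  imports Defs
begin

no_notation fps_nth (infixl "$" 75)

section \<open>Irreducible components and chains\<close>

lemma irreducible_in_subtopology:
  assumes "irreducible_in T Y" "Y \<subseteq> S"
  shows "irreducible_in (subtopology T S) Y"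
  unfolding irreducible_in_def
proof (intro conjI allI impI)
  show "Y \<subseteq> topspace (subtopology T S)" "Y \<noteq> {}"
    using assms by (auto simp: irreducible_in_def)
  fix C D
  assume CD: "closedin (subtopology T S) C \<and> closedin (subtopology T S) D \<and> Y \<subseteq> C \<union> D"
  then obtain C' D' where "closedin T C'" "C = C' \<inter> S" "closedin T D'" "D = D' \<inter> S"
    unfolding closedin_subtopology by blast
  moreover from this CD have "Y \<subseteq> C' \<union> D'" by blast
  ultimately have "Y \<subseteq> C' \<or> Y \<subseteq> D'"
    using assms(1) unfolding irreducible_in_def by blast
  then show "Y \<subseteq> C \<or> Y \<subseteq> D"
    using \<open>C = C' \<inter> S\<close> \<open>D = D' \<inter> S\<close> assms(2) by blast
qed

text \<open>If the union were contained in neither \<open>C\<close> nor \<open>D\<close>, one member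
  of the chain would escape \<open>C\<close> and another \<open>D\<close>. Each lies in the other
  closed set, so the larger of the two would lie in a set that one of them escapes. This is the
  upper bound needed for Zorn's lemma.\<close>

lemma irreducible_in_Union_chain:
  assumes chain: "subset.chain {Y. irreducible_in T Y} K" and "K \<noteq> {}"
  shows "irreducible_in T (\<Union>K)"
  unfolding irreducible_in_def
proof (intro conjI allI impI)
  have irr: "irreducible_in T Y" if "Y \<in> K" for Y
    using chain that by (auto simp: subset_chain_def)
  have total: "V \<subseteq> Y \<or> Y \<subseteq> V" if "V \<in> K" "Y \<in> K" for V Y
    using chain that by (auto simp: subset_chain_def)
  show "\<Union>K \<subseteq> topspace T" "\<Union>K \<noteq> {}"
    using irr \<open>K \<noteq> {}\<close> by (auto simp: irreducible_in_def)
  fix C D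
  assume CD: "closedin T C \<and> closedin T D \<and> \<Union>K \<subseteq> C \<union> D"
  then have each: "Y \<subseteq> C \<or> Y \<subseteq> D" if "Y \<in> K" for Y
  proof -
    have "Y \<subseteq> C \<union> D" using CD that by blast
    then show ?thesis using irr[OF that] CD unfolding irreducible_in_def by blast
  qed
  show "\<Union>K \<subseteq> C \<or> \<Union>K \<subseteq> D"
  proof (rule ccontr)
    assume "\<not> ?thesis"
    then obtain V Y where "V \<in> K" "\<not> V \<subseteq> C" "Y \<in> K" "\<not> Y \<subseteq> D" by blast
    moreover from this have "V \<subseteq> D" "Y \<subseteq> C" using each by blast+
    ultimately show False using total[of V Y] by blast
  qed
qed

lemma irreducible_component_superset:
  assumes "irreducible_in T Y"
  obtains Z where "Z \<in> irreducible_components_of T" "Y \<subseteq> Z"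
proof -
  let ?F = "{Z. irreducible_in T Z \<and> Y \<subseteq> Z}"
  have "\<exists>M\<in>?F. \<forall>V\<in>?F. M \<subseteq> V \<longrightarrow> V = M"
  proof (rule subset_Zorn_nonempty)
    show "?F \<noteq> {}" using assms by auto
    fix K assume "K \<noteq> {}" and chain: "subset.chain ?F K"
    then have "subset.chain {Y. irreducible_in T Y} K"
      by (auto simp: subset_chain_def)
    then have "irreducible_in T (\<Union>K)"
      using \<open>K \<noteq> {}\<close> by (rule irreducible_in_Union_chain)
    moreover have "Y \<subseteq> \<Union>K"
      using chain \<open>K \<noteq> {}\<close> unfolding subset_chain_def by blast
    ultimately show "\<Union>K \<in> ?F" by simp
  qed
  then obtain M where M: "irreducible_in T M" "Y \<subseteq> M"
    and max: "\<And>V. irreducible_in T V \<Longrightarrow> Y \<subseteq> V \<Longrightarrow> M \<subseteq> V \<Longrightarrow> V = M" by auto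
  have "M \<in> irreducible_components_of T"
    unfolding irreducible_components_of_def using M max by (simp add: subset_trans[of Y M])
  from this M(2) show thesis by (rule that)
qed

text \<open>The largest set \<open>W n\<close> lies in some component \<open>Z\<close>. Closedness
  and irreducibility of all \<open>W i\<close> pass to the subspace \<open>Z\<close>, so the chain
  is counted by the dimension of \<open>Z\<close>.\<close>

lemma component_krull_dim_ge:
  assumes W: "\<And>i. i \<le> n \<Longrightarrow> closedin T (W i) \<and> irreducible_in T (W i)"
    and strict: "\<And>i. i < n \<Longrightarrow> W i \<subset> W (Suc i)"
  shows "\<exists>Z \<in> irreducible_components_of T. krull_dim (subtopology T Z) \<ge> enat n"
proof -
  have "irreducible_in T (W n)" using W by simp
  then obtain Z where Z: "Z \<in> irreducible_components_of T" "W n \<subseteq> Z"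
    by (rule irreducible_component_superset)
  have "W i \<subseteq> W n" if "i \<le> n" for i
    using that by (induction rule: inc_induct) (use strict in auto)
  then have sub: "W i \<subseteq> Z" if "i \<le> n" for i
    using that Z(2) by blast
  have "closedin (subtopology T Z) (W i) \<and> irreducible_in (subtopology T Z) (W i)"
    if "i \<le> n" for i
    using W[OF that] sub[OF that] closedin_subset_topspace irreducible_in_subtopology by blast
  then have "\<exists>V. (\<forall>i\<le>n. closedin (subtopology T Z) (V i) \<and> irreducible_in (subtopology T Z) (V i))
      \<and> (\<forall>i<n. V i \<subset> V (Suc i))"
    using strict by (intro exI[of _ W]) simp
  then have "enat n \<le> krull_dim (subtopology T Z)"
    unfolding krull_dim_def by (intro Sup_upper CollectI exI[of _ n]) simp
  with Z(1) show ?thesis by blast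
qed

section \<open>Closures of points of the toric Hilbert scheme\<close>

text \<open>A basic open set says \<open>f \<notin> Q\<close>, which is inherited by every smaller
  prime; unions and finite intersections preserve this.\<close>

lemma openin_X_zariski_generization:
  assumes "openin (X_zariski A) U" "Q \<in> U" "P \<in> X_points A" "P \<subseteq> Q"
  shows "P \<in> U"
proof -
  have "generate_topology_on {{P \<in> X_points A. f \<notin> P} | f. f \<in> carrier (X_ring A)} U"
    using assms(1) unfolding X_zariski_def by (rule openin_topology_generated_by)
  then show ?thesis
    using assms(2) by induction (use assms(3,4) in auto)
qed

lemma topspace_X_zariski:
  "topspace (X_zariski A :: ((nat ^ 'n \<Rightarrow>\<^sub>0 nat) \<Rightarrow>\<^sub>0 'k::field) set topology) = X_points A"
proof
  show "topspace (X_zariski A) \<subseteq> X_points A"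
    by (auto simp: X_zariski_def topology_generated_by_topspace)
  show "X_points A \<subseteq> topspace (X_zariski A)"
  proof
    fix P assume P: "P \<in> X_points A"
    then interpret primeideal P "X_ring A" by (simp add: X_points_def)
    obtain f where "f \<in> carrier (X_ring A)" "f \<notin> P"
      using I_notcarr a_subset by blast
    with P show "P \<in> topspace (X_zariski A)"
      unfolding X_zariski_def topology_generated_by_topspace by blast
  qed
qed

text \<open>The points of \<open>H\<close> above \<open>P\<close> form the closure of
  \<open>P\<close> in \<open>H\<close>. It is irreducible because a closed set that contains
  \<open>P\<close> contains all of it.\<close>

lemma point_closure:
  fixes P :: "((nat ^ 'n \<Rightarrow>\<^sub>0 nat) \<Rightarrow>\<^sub>0 'k::field) set"
  assumes P: "P \<in> H" and H: "H \<subseteq> X_points A"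
  defines "T \<equiv> subtopology (X_zariski A) H"
  shows "closedin T {Q \<in> H. P \<subseteq> Q}" "irreducible_in T {Q \<in> H. P \<subseteq> Q}"
proof -
  have top: "topspace T = H" using H by (auto simp: T_def topspace_X_zariski)
  have "P \<subseteq> carrier (X_ring A)"
  proof -
    interpret primeideal P "X_ring A" using P H by (auto simp: X_points_def)
    show ?thesis by (rule a_subset)
  qed
  then have "openin (X_zariski A) {Q \<in> X_points A. f \<notin> Q}" if "f \<in> P" for f
    using that unfolding X_zariski_def by (intro topology_generated_by_Basis) blast
  then have "openin (X_zariski A) (\<Union>f\<in>P. {Q \<in> X_points A. f \<notin> Q})" by blast
  then have "openin T (H \<inter> (\<Union>f\<in>P. {Q \<in> X_points A. f \<notin> Q}))"
    unfolding T_def by (rule openin_subtopology_Int2)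
  moreover have "H \<inter> (\<Union>f\<in>P. {Q \<in> X_points A. f \<notin> Q}) = H - {Q \<in> H. P \<subseteq> Q}"
    using H by auto
  ultimately show "closedin T {Q \<in> H. P \<subseteq> Q}"
    by (simp add: closedin_def top)
  have spec: "{Q \<in> H. P \<subseteq> Q} \<subseteq> C" if C: "closedin T C" "P \<in> C" for C
  proof
    fix Q assume Q: "Q \<in> {Q \<in> H. P \<subseteq> Q}"
    obtain D where D: "closedin (X_zariski A) D" "C = D \<inter> H"
      using C(1) unfolding T_def closedin_subtopology by blast
    have "Q \<in> D"
    proof (rule ccontr)
      assume "Q \<notin> D"
      have "P \<in> X_points A - D"
      proof (rule openin_X_zariski_generization)
        show "openin (X_zariski A) (X_points A - D)"
          using D(1) by (simp add: closedin_def topspace_X_zariski)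
        show "Q \<in> X_points A - D" "P \<in> X_points A" "P \<subseteq> Q"
          using Q H P \<open>Q \<notin> D\<close> by blast+
      qed
      then show False using D(2) C(2) by blast
    qed
    then show "Q \<in> C" using D(2) Q by blast
  qed
  show "irreducible_in T {Q \<in> H. P \<subseteq> Q}"
    unfolding irreducible_in_def top
  proof (intro conjI allI impI)
    have "P \<in> {Q \<in> H. P \<subseteq> Q}" using P by simp
    then show "{Q \<in> H. P \<subseteq> Q} \<noteq> {}" by blast
    fix C D
    assume "closedin T C \<and> closedin T D \<and> {Q \<in> H. P \<subseteq> Q} \<subseteq> C \<union> D"
    moreover from this have "P \<in> C \<or> P \<in> D"
      using \<open>P \<in> {Q \<in> H. P \<subseteq> Q}\<close> by blast
    ultimately show "{Q \<in> H. P \<subseteq> Q} \<subseteq> C \<or> {Q \<in> H. P \<subseteq> Q} \<subseteq> D"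
      using spec by (elim conjE disjE) simp_all
  qed auto
qed

section \<open>Evaluation homomorphisms\<close>

lemma poly_mapping_add_induct [case_names zero single add]:
  fixes f :: "'a \<Rightarrow>\<^sub>0 'b::comm_monoid_add"
  assumes zero: "P 0" and single: "\<And>m a. P (Poly_Mapping.single m a)"
    and add: "\<And>f g. P f \<Longrightarrow> P g \<Longrightarrow> P (f + g)"
  shows "P f"
proof (induction f rule: Poly_Mapping.update_induct)
  case const
  show ?case by (rule zero)
next
  case (update f a b)
  have "Poly_Mapping.update a b f = Poly_Mapping.single a b + f"
    using update(1)
    by (intro poly_mapping_eqI)
       (auto simp: lookup_add lookup_update lookup_single when_def in_keys_iff)
  then show ?case using single add update(3) by simp
qed

definition eval_monom :: "('v \<Rightarrow> 'r::comm_semiring_1) \<Rightarrow> ('v \<Rightarrow>\<^sub>0 nat) \<Rightarrow> 'r" where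
  "eval_monom c m = (\<Prod>u\<in>Poly_Mapping.keys m. c u ^ Poly_Mapping.lookup m u)"

lemma eval_monom_superset:
  assumes "finite K" "Poly_Mapping.keys m \<subseteq> K"
  shows "eval_monom c m = (\<Prod>u\<in>K. c u ^ Poly_Mapping.lookup m u)"
  unfolding eval_monom_def using assms
  by (intro prod.mono_neutral_left) (auto simp: in_keys_iff)

lemma eval_monom_zero [simp]: "eval_monom c 0 = 1"
  by (simp add: eval_monom_def)

lemma eval_monom_single [simp]: "eval_monom c (Poly_Mapping.single u n) = c u ^ n"
  by (simp add: eval_monom_def)

lemma eval_monom_add: "eval_monom c (m + m') = eval_monom c m * eval_monom c m'"
proof -
  let ?K = "Poly_Mapping.keys m \<union> Poly_Mapping.keys m'"
  have "eval_monom c (m + m') = (\<Prod>u\<in>?K. c u ^ Poly_Mapping.lookup (m + m') u)"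
    by (intro eval_monom_superset) (use keys_add[of m m'] in auto)
  also have "\<dots> = eval_monom c m * eval_monom c m'"
    by (simp add: lookup_add power_add prod.distrib eval_monom_superset[of ?K])
  finally show ?thesis .
qed

text \<open>The \<open>k\<close>-algebra homomorphism with \<open>xi u\<close> mapped to
  \<open>c u\<close>; \<open>Poly_Mapping.single 0\<close> embeds the constants into the
  target.\<close>

definition poly_subst ::
  "('v \<Rightarrow> 'w::comm_monoid_add \<Rightarrow>\<^sub>0 'k) \<Rightarrow> (('v \<Rightarrow>\<^sub>0 nat) \<Rightarrow>\<^sub>0 'k) \<Rightarrow> 'w \<Rightarrow>\<^sub>0 'k::comm_ring_1" where
  "poly_subst c f =
     (\<Sum>m\<in>Poly_Mapping.keys f. Poly_Mapping.single 0 (Poly_Mapping.lookup f m) * eval_monom c m)"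

lemma poly_subst_zero [simp]: "poly_subst c 0 = 0"
  by (simp add: poly_subst_def)

lemma poly_subst_single [simp]:
  "poly_subst c (Poly_Mapping.single m a) = Poly_Mapping.single 0 a * eval_monom c m"
  by (simp add: poly_subst_def)

lemma poly_subst_add: "poly_subst c (f + g) = poly_subst c f + poly_subst c g"
  unfolding poly_subst_def
  by (rule setsum_keys_plus_distrib) (simp_all add: single_add distrib_right)

lemma poly_subst_mult:
  fixes c :: "'v \<Rightarrow> 'w::comm_monoid_add \<Rightarrow>\<^sub>0 'k::comm_ring_1"
  shows "poly_subst c (f * g) = poly_subst c f * poly_subst c g"
proof (induction f rule: poly_mapping_add_induct)
  case (single m a)
  show ?case
  proof (induction g rule: poly_mapping_add_induct)
    case (single m' a')
    have "poly_subst c (Poly_Mapping.single m a * Poly_Mapping.single m' a')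
        = (Poly_Mapping.single 0 a * Poly_Mapping.single 0 a') * (eval_monom c m * eval_monom c m')"
      by (simp add: mult_single eval_monom_add)
    then show ?case by (simp add: ac_simps)
  qed (simp_all add: poly_subst_add distrib_left)
qed (simp_all add: poly_subst_add distrib_right)

lemma poly_subst_hom: "comm_ring_hom (poly_subst c)"
proof
  show "poly_subst c 1 = 1"
    using poly_subst_single[of c 0 1] by simp
qed (simp_all add: poly_subst_add poly_subst_mult)

lemma poly_subst_xi [simp]: "poly_subst c (xi u) = c u"
  by (simp add: xi_def)

lemma poly_subst_subst:
  "poly_subst d (poly_subst c f) = poly_subst (\<lambda>u. poly_subst d (c u)) f"
proof (induction f rule: poly_mapping_add_induct)
  case (single m a)
  interpret comm_ring_hom "poly_subst d" by (rule poly_subst_hom)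
  have "poly_subst d (eval_monom c m) = eval_monom (\<lambda>u. poly_subst d (c u)) m"
    by (simp add: eval_monom_def hom_prod hom_power)
  then show ?case by (simp add: hom_mult)
qed (simp_all add: poly_subst_add)

section \<open>Compatibility of substitutions with gradings\<close>

lemma lookup_graded_component:
  "Poly_Mapping.lookup (graded_component gdeg e f) m = (if gdeg m = e then Poly_Mapping.lookup f m else 0)"
proof -
  have "Poly_Mapping.lookup (graded_component gdeg e f) m =
      (\<Sum>m'\<in>{m'\<in>Poly_Mapping.keys f. gdeg m' = e}. if m' = m then Poly_Mapping.lookup f m else 0)"
    unfolding graded_component_def lookup_sum
    by (intro sum.cong) (auto simp: lookup_single when_def)
  also have "\<dots> = (if m \<in> {m'\<in>Poly_Mapping.keys f. gdeg m' = e} then Poly_Mapping.lookup f m else 0)"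
    by (subst sum.delta) simp_all
  finally show ?thesis by (auto simp: in_keys_iff)
qed

lemma graded_component_zero [simp]: "graded_component gdeg e 0 = 0"
  by (simp add: graded_component_def)

lemma graded_component_add:
  "graded_component gdeg e (f + g) = graded_component gdeg e f + graded_component gdeg e g"
  by (intro poly_mapping_eqI) (simp add: lookup_graded_component lookup_add)

lemma graded_component_of_piece:
  assumes "f \<in> graded_piece gdeg e'"
  shows "graded_component gdeg e f = (if e' = e then f else 0)"
  using assms
  by (intro poly_mapping_eqI) (auto simp: lookup_graded_component graded_piece_def in_keys_iff)

lemma graded_piece_mult:
  assumes "f \<in> graded_piece gdeg e" "g \<in> graded_piece gdeg e'"
    and "\<And>m m'. gdeg (m + m') = (\<lambda>b. gdeg m b + gdeg m' b)"
  shows "f * g \<in> graded_piece gdeg (\<lambda>b. e b + e' b)"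
  using assms keys_mult[of f g] unfolding graded_piece_def by fastforce

lemma poly_subst_graded_component:
  assumes mon: "\<And>m. eval_monom c m \<in> graded_piece tdeg (sdeg m)"
  shows "poly_subst c (graded_component sdeg e f) = graded_component tdeg e (poly_subst c f)"
proof (induction f rule: poly_mapping_add_induct)
  case (single m a)
  have "Poly_Mapping.single 0 a * eval_monom c m \<in> graded_piece tdeg (sdeg m)"
    using mon[of m] keys_mult[of "Poly_Mapping.single 0 a" "eval_monom c m"]
    by (fastforce simp: graded_piece_def split: if_splits)
  moreover have "Poly_Mapping.single m a \<in> graded_piece sdeg (sdeg m)"
    by (simp add: graded_piece_def)
  ultimately show ?case by (simp add: graded_component_of_piece)
qed (simp_all add: poly_subst_add graded_component_add)

section \<open>Points of the toric Hilbert scheme from evaluation homomorphisms\<close>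

lemma carrier_X_ring:
  "carrier (X_ring A) =
     {f. \<forall>m\<in>Poly_Mapping.keys f. \<forall>u\<in>Poly_Mapping.keys m. adeg A u \<in> graver_degrees A}"
  by (simp add: X_ring_def)

lemma X_ring_simps [simp]:
  "x \<otimes>\<^bsub>X_ring A\<^esub> y = x * y" "x \<oplus>\<^bsub>X_ring A\<^esub> y = x + y" "\<one>\<^bsub>X_ring A\<^esub> = 1" "\<zero>\<^bsub>X_ring A\<^esub> = 0"
  by (simp_all add: X_ring_def ring_of_type_algebra_def)

lemma X_ring_closed:
  fixes f g :: "(nat ^ 'n \<Rightarrow>\<^sub>0 nat) \<Rightarrow>\<^sub>0 'k::field"
  shows "1 \<in> carrier (X_ring A :: ((nat ^ 'n \<Rightarrow>\<^sub>0 nat) \<Rightarrow>\<^sub>0 'k) ring)"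
    and "0 \<in> carrier (X_ring A :: ((nat ^ 'n \<Rightarrow>\<^sub>0 nat) \<Rightarrow>\<^sub>0 'k) ring)"
    and "f \<in> carrier (X_ring A) \<Longrightarrow> - f \<in> carrier (X_ring A)"
    and "f \<in> carrier (X_ring A) \<Longrightarrow> g \<in> carrier (X_ring A) \<Longrightarrow> f + g \<in> carrier (X_ring A)"
    and "f \<in> carrier (X_ring A) \<Longrightarrow> g \<in> carrier (X_ring A) \<Longrightarrow> f * g \<in> carrier (X_ring A)"
proof -
  show "f + g \<in> carrier (X_ring A)" if "f \<in> carrier (X_ring A)" "g \<in> carrier (X_ring A)"
    using that keys_add[of f g] unfolding carrier_X_ring by blast
  show "f * g \<in> carrier (X_ring A)" if f: "f \<in> carrier (X_ring A)" and g: "g \<in> carrier (X_ring A)"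
    unfolding carrier_X_ring
  proof (intro CollectI ballI)
    fix m u assume "m \<in> Poly_Mapping.keys (f * g)" and u: "u \<in> Poly_Mapping.keys m"
    then obtain m1 m2 where m: "m = m1 + m2" "m1 \<in> Poly_Mapping.keys f" "m2 \<in> Poly_Mapping.keys g"
      using keys_mult[of f g] by blast
    then have "u \<in> Poly_Mapping.keys m1 \<or> u \<in> Poly_Mapping.keys m2"
      using u keys_add[of m1 m2] by blast
    then show "adeg A u \<in> graver_degrees A"
      using m f g unfolding carrier_X_ring by blast
  qed
qed (simp_all add: carrier_X_ring keys_def lookup_one when_def)

lemma X_ring_sum_closed:
  "(\<And>i. i \<in> K \<Longrightarrow> f i \<in> carrier (X_ring A)) \<Longrightarrow> sum f K \<in> carrier (X_ring A)"
  by (induction K rule: infinite_finite_induct) (simp_all add: X_ring_closed)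

lemma X_ring_prod_closed:
  "(\<And>i. i \<in> K \<Longrightarrow> f i \<in> carrier (X_ring A)) \<Longrightarrow> prod f K \<in> carrier (X_ring A)"
  by (induction K rule: infinite_finite_induct) (simp_all add: X_ring_closed)

lemma xi_in_X_ring: "adeg A u \<in> graver_degrees A \<Longrightarrow> xi u \<in> carrier (X_ring A)"
  by (simp add: carrier_X_ring xi_def)

lemma cring_X_ring:
  "cring (X_ring A :: ((nat ^ 'n \<Rightarrow>\<^sub>0 nat) \<Rightarrow>\<^sub>0 'k::field) ring)"
proof -
  let ?R = "ring_of_type_algebra :: ((nat ^ 'n \<Rightarrow>\<^sub>0 nat) \<Rightarrow>\<^sub>0 'k) ring"
  interpret R: cring ?R by (rule cring_from_type_algebra)
  have uminus: "\<ominus>\<^bsub>?R\<^esub> f = - f" for f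
    by (rule R.minus_equality) (simp_all add: ring_of_type_algebra_def)
  have "subring (carrier (X_ring A)) ?R"
  proof (rule R.subringI)
    show "\<ominus>\<^bsub>?R\<^esub> h \<in> carrier (X_ring A)" if "h \<in> carrier (X_ring A)" for h
      using that by (simp add: uminus X_ring_closed)
  qed (simp_all add: ring_of_type_algebra_def X_ring_closed)
  then have "cring (?R \<lparr>carrier := carrier (X_ring A)\<rparr>)"
    using R.subcringI' R.subcring_iff by (simp add: ring_of_type_algebra_def)
  then show ?thesis by (simp add: X_ring_def)
qed

lemma domain_type_algebra: "domain (ring_of_type_algebra :: 'r::idom ring)"
proof -
  interpret cring "ring_of_type_algebra :: 'r ring" by (rule cring_from_type_algebra)
  show ?thesis by unfold_locales (auto simp: ring_of_type_algebra_def)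
qed

text \<open>The kernel is the preimage of the zero ideal of a domain. The linear order on
  \<open>'w\<close> induces a monomial order, which makes the target polynomial ring a
  domain.\<close>

lemma primeideal_poly_subst_kernel:
  fixes c :: "nat ^ 'n \<Rightarrow> ('w::linorder \<Rightarrow>\<^sub>0 nat) \<Rightarrow>\<^sub>0 'k::field"
  shows "primeideal {f \<in> carrier (X_ring A). poly_subst c f = 0} (X_ring A)"
proof -
  let ?R = "ring_of_type_algebra :: (('w \<Rightarrow>\<^sub>0 nat) \<Rightarrow>\<^sub>0 'k) ring"
  interpret hom: comm_ring_hom "poly_subst c" by (rule poly_subst_hom)
  interpret S: domain ?R by (rule domain_type_algebra)
  interpret R: cring "X_ring A :: ((nat ^ 'n \<Rightarrow>\<^sub>0 nat) \<Rightarrow>\<^sub>0 'k) ring" by (rule cring_X_ring)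
  interpret ring_hom_ring "X_ring A" ?R "poly_subst c"
    by (rule ring_hom_ringI)
       (use R.ring_axioms S.ring_axioms in
         \<open>simp_all add: ring_of_type_algebra_def hom.hom_mult hom.hom_add\<close>)
  have "primeideal {r \<in> carrier (X_ring A). poly_subst c r \<in> {\<zero>\<^bsub>?R\<^esub>}} (X_ring A)"
    by (rule primeideal_vimage[OF R.cring_axioms S.zeroprimeideal])
  then show ?thesis by (simp add: ring_of_type_algebra_def)
qed

text \<open>The variable \<open>code b\<close> homogenizes degree \<open>b\<close>: it occurs
  exactly once in each term of \<open>c u\<close> if \<open>u\<close> has degree \<open>b\<close>,
  and not at all otherwise. Its exponent in the image of a monomial therefore counts the factors of
  degree \<open>b\<close>, which is the multidegree.\<close>

lemma eval_monom_graded_piece: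
  fixes c :: "nat ^ 'n \<Rightarrow> ('w \<Rightarrow>\<^sub>0 nat) \<Rightarrow>\<^sub>0 'k::field" and code :: "int ^ 'd \<Rightarrow> 'w"
  assumes deg: "\<And>u x b. x \<in> Poly_Mapping.keys (c u)
      \<Longrightarrow> Poly_Mapping.lookup x (code b) = (if adeg A u = b then 1 else 0)"
  shows "eval_monom c m \<in> graded_piece (\<lambda>x b. Poly_Mapping.lookup x (code b)) (multidegree A m)"
proof -
  let ?g = "\<lambda>x b. Poly_Mapping.lookup x (code b)"
  have one: "1 \<in> graded_piece ?g (\<lambda>b. 0)"
    by (simp add: graded_piece_def)
  have mult: "f * g \<in> graded_piece ?g (\<lambda>b. e b + e' b)"
    if "f \<in> graded_piece ?g e" "g \<in> graded_piece ?g e'" for f g :: "('w \<Rightarrow>\<^sub>0 nat) \<Rightarrow>\<^sub>0 'k" and e e'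
    using that by (rule graded_piece_mult) (simp add: lookup_add)
  have pow: "c u ^ n \<in> graded_piece ?g (\<lambda>b. if adeg A u = b then n else 0)" for u n
  proof (induction n)
    case (Suc n)
    have "c u \<in> graded_piece ?g (\<lambda>b. if adeg A u = b then 1 else 0)"
      using deg by (auto simp: graded_piece_def)
    moreover have "(\<lambda>b. (if adeg A u = b then 1 else 0) + (if adeg A u = b then n else 0))
        = (\<lambda>b. if adeg A u = b then Suc n else 0)" by auto
    ultimately show ?case using mult[OF _ Suc] by fastforce
  qed (use one in simp)
  have "(\<Prod>u\<in>K. c u ^ Poly_Mapping.lookup m u)
      \<in> graded_piece ?g (\<lambda>b. \<Sum>u\<in>K. if adeg A u = b then Poly_Mapping.lookup m u else 0)"
    if "finite K" for K
    using that by induction (use one mult pow in simp_all)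
  from this[of "Poly_Mapping.keys m"] show ?thesis
    by (simp add: eval_monom_def multidegree_def sum.inter_filter)
qed

text \<open>The substitution carries the multidegree to the exponents of the homogenizing variables,
  so it commutes with taking components and its kernel is multihomogeneous. By
  \<open>nonzero\<close> the kernel contains no irrelevant ideal.\<close>

lemma poly_subst_kernel_X_point:
  fixes A :: "int ^ 'n ^ 'd" and c :: "nat ^ 'n \<Rightarrow> ('w::linorder \<Rightarrow>\<^sub>0 nat) \<Rightarrow>\<^sub>0 'k::field"
  assumes deg: "\<And>u x b. x \<in> Poly_Mapping.keys (c u)
      \<Longrightarrow> Poly_Mapping.lookup x (code b) = (if adeg A u = b then 1 else 0)"
    and nonzero: "\<And>b. b \<in> graver_degrees A \<Longrightarrow> \<exists>u. adeg A u = b \<and> c u \<noteq> 0"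
  shows "{f \<in> carrier (X_ring A). poly_subst c f = 0} \<in> X_points A"
proof -
  have "homogeneous_set (multidegree A) {f \<in> carrier (X_ring A). poly_subst c f = 0}"
    unfolding homogeneous_set_def
  proof (intro ballI allI CollectI conjI)
    fix f e assume f: "f \<in> {f \<in> carrier (X_ring A). poly_subst c f = 0}"
    have "Poly_Mapping.keys (graded_component (multidegree A) e f) \<subseteq> Poly_Mapping.keys f"
      by (auto simp: in_keys_iff lookup_graded_component split: if_splits)
    then show "graded_component (multidegree A) e f \<in> carrier (X_ring A)"
      using f unfolding carrier_X_ring by blast
    show "poly_subst c (graded_component (multidegree A) e f) = 0"
      using f by (simp add: poly_subst_graded_component[where c = c,
          OF eval_monom_graded_piece[where c = c and code = code, OF deg]])
  qed
  then show ?thesis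
    using nonzero by (auto simp: X_points_def primeideal_poly_subst_kernel)
qed

lemma maximal_minors_poly_subst_kernel:
  fixes A :: "int ^ 'n ^ 'd" and c :: "nat ^ 'n \<Rightarrow> ('w::linorder \<Rightarrow>\<^sub>0 nat) \<Rightarrow>\<^sub>0 'k::field"
  assumes rel: "\<And>\<alpha> \<beta> \<gamma>. adeg A \<alpha> = adeg A \<beta> \<Longrightarrow> c (\<gamma> + \<beta>) * c \<alpha> = c (\<gamma> + \<alpha>) * c \<beta>"
    and nonzero: "adeg A w0 = b" "c w0 \<noteq> 0"
  shows "maximal_minors A b \<subseteq> {f \<in> carrier (X_ring A). poly_subst c f = 0}"
proof
  fix D :: "(nat ^ 'n \<Rightarrow>\<^sub>0 nat) \<Rightarrow>\<^sub>0 'k"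
  assume "D \<in> maximal_minors A b"
  then obtain rs cs where
    rs: "distinct rs" "set rs = M_rows A b" and cs: "set cs \<subseteq> M_columns A b" "length cs = length rs"
    and D: "D = Determinant.det (Matrix.mat (length rs) (length rs) (\<lambda>(i, j). M_entry (rs ! i) (cs ! j)))"
    unfolding maximal_minors_def by blast
  interpret hom: comm_ring_hom "poly_subst c" by (rule poly_subst_hom)
  let ?n = "length rs"
  let ?M = "Matrix.mat ?n ?n (\<lambda>(i, j). M_entry (rs ! i) (cs ! j)) :: ((nat ^ 'n \<Rightarrow>\<^sub>0 nat) \<Rightarrow>\<^sub>0 'k) mat"
  have col: "cs ! j \<in> M_columns A b" if "j < ?n" for j
    using cs that nth_mem by fastforce
  have M: "?M \<in> carrier_mat ?n ?n" by simp
  have entry: "M_entry w q \<in> carrier (X_ring A)" if q: "q \<in> M_columns A b" for w q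
    using q by (auto simp: M_entry_def M_columns_def xi_in_X_ring X_ring_closed)
  \<comment> \<open>By the Leibniz expansion, since every entry lies in the subring.\<close>
  have "D \<in> carrier (X_ring A)"
    unfolding D det_def'[OF M]
  proof (intro X_ring_sum_closed X_ring_closed X_ring_prod_closed)
    fix p assume p: "p \<in> {p. p permutes {0..<?n}}"
    show "signof p \<in> carrier (X_ring A)"
      by (simp add: sign_def X_ring_closed)
    fix i assume "i \<in> {0..<?n}"
    then have "i < ?n" "p i < ?n"
      using p permutes_in_image[of p "{0..<?n}" i] by auto
    then show "?M $$ (i, p i) \<in> carrier (X_ring A)"
      using entry[OF col] by simp
  qed
  moreover have "poly_subst c D = 0"
  proof -
    let ?N = "map_mat (poly_subst c) ?M"
    let ?v = "Matrix.vec ?n (\<lambda>i. c (rs ! i))"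
    have N: "?N \<in> carrier_mat ?n ?n" by simp
    have "w0 \<in> set rs" using rs nonzero by (simp add: M_rows_def)
    then obtain i0 where i0: "i0 < ?n" "rs ! i0 = w0" by (auto simp: in_set_conv_nth)
    \<comment> \<open>Over a domain, a nonzero vector killed by the transposed matrix forces the
      determinant to vanish. The vector is \<open>c\<close> restricted to the rows, and
      \<open>w0\<close> supplies a nonzero entry.\<close>
    have "?v \<noteq> 0\<^sub>v ?n"
    proof
      assume "?v = 0\<^sub>v ?n"
      then have "Matrix.vec_index ?v i0 = Matrix.vec_index (0\<^sub>v ?n) i0" by simp
      then show False using i0 nonzero by simp
    qed
    moreover have "transpose_mat ?N *\<^sub>v ?v = 0\<^sub>v ?n"
    proof (rule eq_vecI)
      fix j assume "j < dim_vec (0\<^sub>v ?n :: (('w \<Rightarrow>\<^sub>0 nat) \<Rightarrow>\<^sub>0 'k) Matrix.vec)"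
      then have j: "j < ?n" by simp
      obtain \<alpha> \<beta> \<gamma> where q: "cs ! j = (\<alpha>, \<beta>, \<gamma>)" by (cases "cs ! j") auto
      have ab: "\<alpha> \<noteq> \<beta>" "adeg A \<alpha> = adeg A \<beta>" "\<gamma> + \<alpha> \<in> set rs" "\<gamma> + \<beta> \<in> set rs"
        using col[OF j] by (auto simp: q M_columns_def rs M_rows_def)
      have "Matrix.vec_index (transpose_mat ?N *\<^sub>v ?v) j
          = (\<Sum>i\<in>{0..<?n}. poly_subst c (M_entry (rs ! i) (cs ! j)) * c (rs ! i))"
        using j by (simp add: scalar_prod_def)
      also have "\<dots> = (\<Sum>w\<in>set rs. poly_subst c (M_entry w (cs ! j)) * c w)"
      proof (rule sum.reindex_bij_betw)
        show "bij_betw ((!) rs) {0..<?n} (set rs)"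
          using rs(1) by (simp add: bij_betw_nth lessThan_atLeast0)
      qed
      \<comment> \<open>Since \<open>\<alpha> \<noteq> \<beta>\<close>, the two nonzero entries of
        the column sit in different rows and the case distinction splits into a sum.\<close>
      also have "\<dots> = (\<Sum>w\<in>set rs. (if w = \<gamma> + \<beta> then c \<alpha> * c (\<gamma> + \<beta>) else 0)
          + (if w = \<gamma> + \<alpha> then - c \<beta> * c (\<gamma> + \<alpha>) else 0))"
        using ab(1) by (intro sum.cong) (auto simp: q M_entry_def hom.hom_uminus)
      also have "\<dots> = c \<alpha> * c (\<gamma> + \<beta>) - c \<beta> * c (\<gamma> + \<alpha>)"
        using ab(3,4) by (simp add: sum.distrib)
      also have "\<dots> = 0" using rel[OF ab(2), of \<gamma>] by (simp add: mult.commute)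
      finally show "Matrix.vec_index (transpose_mat ?N *\<^sub>v ?v) j = Matrix.vec_index (0\<^sub>v ?n) j"
        using j by simp
    qed simp
    ultimately have "Determinant.det (transpose_mat ?N) = 0"
      using det_0_iff_vec_prod_zero[of "transpose_mat ?N" ?n] N
      by (metis transpose_carrier_mat vec_carrier)
    then show ?thesis
      using hom.hom_det[of ?M] det_transpose[OF N] D by simp
  qed
  ultimately show "D \<in> {f \<in> carrier (X_ring A). poly_subst c f = 0}" by simp
qed

section \<open>Reduced monomials for the matrices \<open>A(j)\<close>\<close>

lemma UNIV_5: "(UNIV :: 5 set) = {1, 2, 3, 4, 5}"
proof -
  have "i = 1 \<or> i = 2 \<or> i = 3 \<or> i = 4 \<or> i = 5" for i :: 5
  proof (cases i)
    case (of_int z)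
    then have "z = 0 \<or> z = 1 \<or> z = 2 \<or> z = 3 \<or> z = 4" by auto
    then show ?thesis using of_int by auto
  qed
  then show ?thesis by auto
qed

lemma all_5: "(\<forall>i::5. P i) \<longleftrightarrow> P 1 \<and> P 2 \<and> P 3 \<and> P 4 \<and> P 5"
proof -
  have "(\<forall>i::5. P i) \<longleftrightarrow> (\<forall>i\<in>{1, 2, 3, 4, 5}. P i)"
    unfolding UNIV_5[symmetric] by simp
  then show ?thesis by simp
qed

lemma sum_5: "(\<Sum>i\<in>(UNIV :: 5 set). f i) = f 1 + f 2 + f 3 + f 4 + f 5"
proof -
  have "distinct [1, 2, 3, 4, 5 :: 5]" by simp
  then have "(\<Sum>i\<in>set [1, 2, 3, 4, 5 :: 5]. f i) = f 1 + (f 2 + (f 3 + (f 4 + (f 5 + 0))))"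
    by (subst sum.distinct_set_conv_list) simp_all
  then show ?thesis by (simp only: UNIV_5 list.set add_0_right add.assoc)
qed

section \<open>Degrees and reducedness in coordinates\<close>

lemma adeg_eq_iff:
  "adeg (A_mat j) u = adeg (A_mat j) v \<longleftrightarrow>
     u$1 + u$2 + u$3 + u$4 + u$5 = v$1 + v$2 + v$3 + v$4 + v$5 \<and>
     u$2 + (3 + 3 * j) * u$3 + (4 + 3 * j) * u$4 + (6 + 3 * j) * u$5
       = v$2 + (3 + 3 * j) * v$3 + (4 + 3 * j) * v$4 + (6 + 3 * j) * v$5"
proof -
  have entry: "adeg (A_mat j) w $ k = (\<Sum>i\<in>UNIV. A_mat j $ k $ i * int (w $ i))" for w k
    by (simp add: adeg_def matrix_vector_mult_def)
  have 1: "adeg (A_mat j) w $ 1 = int (w$1 + w$2 + w$3 + w$4 + w$5)" for w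
    unfolding entry sum_5 A_mat_entries mult_1 of_nat_add by (rule refl)
  have 2: "adeg (A_mat j) w $ 2
      = int (w$2 + (3 + 3 * j) * w$3 + (4 + 3 * j) * w$4 + (6 + 3 * j) * w$5)" for w
    unfolding entry sum_5 A_mat_entries mult_1 mult_zero_left add_0_left
      of_nat_add of_nat_mult of_nat_numeral by (rule refl)
  show ?thesis
    unfolding Finite_Cartesian_Product.vec_eq_iff forall_2 1 2 of_nat_eq_iff by (rule refl)
qed

lemma adeg_add: "adeg A (u + v) = adeg A u + adeg A v"
  by (simp add: adeg_def Finite_Cartesian_Product.vec_eq_iff matrix_vector_mult_def
      sum.distrib distrib_left)

definition expvec :: "nat \<Rightarrow> nat \<Rightarrow> nat \<Rightarrow> nat \<Rightarrow> nat \<Rightarrow> nat ^ 5" where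
  "expvec a b c d e = vector [a, b, c, d, e]"

lemma expvec_nth [simp]:
  "expvec a b c d e $ 1 = a" "expvec a b c d e $ 2 = b" "expvec a b c d e $ 3 = c"
  "expvec a b c d e $ 4 = d" "expvec a b c d e $ 5 = e"
  by (simp_all add: expvec_def vector_def)

text \<open>One degree can contain several reduced monomials, such as \<open>flipU\<close> and
  \<open>flipV\<close>; the parameters live in the ratios of their coefficients.\<close>

definition reduced :: "nat \<Rightarrow> nat ^ 5 \<Rightarrow> bool" where
  "reduced j w \<longleftrightarrow> (\<forall>w'. adeg (A_mat j) w' = adeg (A_mat j) w \<longrightarrow> w' $ 4 \<le> w $ 4)"

text \<open>The x_4-exponent is bounded by the total degree, which the first row of the matrix
  fixes, so a maximum is attained.\<close>

lemma reduced_exists: "\<exists>u. adeg (A_mat j) u = adeg (A_mat j) w \<and> reduced j u"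
proof -
  let ?P = "\<lambda>u. adeg (A_mat j) u = adeg (A_mat j) w"
  have "\<forall>u. ?P u \<longrightarrow> u $ 4 < Suc (w$1 + w$2 + w$3 + w$4 + w$5)"
    by (auto simp: adeg_eq_iff)
  then obtain u where "?P u" "\<forall>v. ?P v \<longrightarrow> v $ 4 \<le> u $ 4"
    using ex_has_greatest_nat[of ?P w "\<lambda>u. u $ 4"] by blast
  then show ?thesis unfolding reduced_def by metis
qed

text \<open>Multiplying a better competitor of \<open>u\<close> by \<open>\<gamma>\<close> gives a
  better competitor of \<open>\<gamma> + u\<close>. Thus the nonreduced monomials are closed under
  multiplication by monomials.\<close>

lemma reduced_summand:
  assumes "reduced j (\<gamma> + u)"
  shows "reduced j u"
  unfolding reduced_def
proof (intro allI impI)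
  fix w assume "adeg (A_mat j) w = adeg (A_mat j) u"
  then have "adeg (A_mat j) (\<gamma> + w) = adeg (A_mat j) (\<gamma> + u)" by (simp add: adeg_add)
  then have "(\<gamma> + w) $ 4 \<le> (\<gamma> + u) $ 4" using assms unfolding reduced_def by blast
  then show "w $ 4 \<le> u $ 4" by simp
qed

lemma reduced_same_degree:
  assumes "reduced j u" "adeg (A_mat j) v = adeg (A_mat j) u"
  shows "reduced j v \<longleftrightarrow> v $ 4 = u $ 4"
  using assms unfolding reduced_def by (metis order_antisym_conv order_refl)

lemma reduced_no_divisor:
  assumes "reduced j w" "adeg (A_mat j) m' = adeg (A_mat j) m" "m $ 4 < m' $ 4"
  shows "\<exists>i. w $ i < m $ i"
proof (rule ccontr)
  assume "\<not> ?thesis"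
  then have le: "m $ i \<le> w $ i" for i by (simp add: not_less)
  have "w = (\<chi> i. w $ i - m $ i) + m"
    using le by (simp add: Finite_Cartesian_Product.vec_eq_iff)
  then have "reduced j m" using assms(1) reduced_summand by metis
  then show False using assms(2,3) unfolding reduced_def by force
qed

text \<open>
  Each alternative excludes a divisor of \<open>x\<^sup>w\<close> because it has the same degree as a monomial with larger
  \<open>x\<^sub>4\<close>-exponent: \<open>x\<^sub>2x\<^sub>3 \<sim> x\<^sub>1x\<^sub>4\<close>, \<open>x\<^sub>1\<^sup>2x\<^sub>5 \<sim> x\<^sub>2\<^sup>2x\<^sub>4\<close>, \<open>x\<^sub>1x\<^sub>3x\<^sub>5 \<sim> x\<^sub>2x\<^sub>4\<^sup>2\<close>, \<open>x\<^sub>3\<^sup>2x\<^sub>5 \<sim> x\<^sub>4\<^sup>3\<close>, and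
  \<open>x\<^sub>2^(1+3i) x\<^sub>5^p \<sim> x\<^sub>1^(3i) x\<^sub>3^p x\<^sub>4\<close> for \<open>i + p = j + 1\<close>.
\<close>

lemma reduced_obstructions:
  assumes "reduced j w"
  shows "w $ 2 = 0 \<or> w $ 3 = 0"
    and "w $ 1 \<le> 1 \<or> w $ 5 = 0"
    and "w $ 1 = 0 \<or> w $ 3 = 0 \<or> w $ 5 = 0"
    and "w $ 3 \<le> 1 \<or> w $ 5 = 0"
    and "i + p = j + 1 \<Longrightarrow> w $ 2 < 1 + 3 * i \<or> w $ 5 < p"
proof -
  have ex5: "(\<exists>i::5. w $ i < m $ i) \<longleftrightarrow>
      w$1 < m$1 \<or> w$2 < m$2 \<or> w$3 < m$3 \<or> w$4 < m$4 \<or> w$5 < m$5" for m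
    using all_5[of "\<lambda>i. \<not> w $ i < m $ i"] by blast
  note obstr = reduced_no_divisor[OF assms, unfolded ex5 adeg_eq_iff]
  show "w $ 2 = 0 \<or> w $ 3 = 0"
    using obstr[of "expvec 1 0 0 1 0" "expvec 0 1 1 0 0"] by auto
  show "w $ 1 \<le> 1 \<or> w $ 5 = 0"
    using obstr[of "expvec 0 2 0 1 0" "expvec 2 0 0 0 1"] by auto
  show "w $ 1 = 0 \<or> w $ 3 = 0 \<or> w $ 5 = 0"
    using obstr[of "expvec 0 1 0 2 0" "expvec 1 0 1 0 1"] by auto
  show "w $ 3 \<le> 1 \<or> w $ 5 = 0"
    using obstr[of "expvec 0 0 0 3 0" "expvec 0 0 2 0 1"] by auto
  show "w $ 2 < 1 + 3 * i \<or> w $ 5 < p" if ip: "i + p = j + 1"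
  proof -
    \<comment> \<open>Equality of the weights in the second row of the matrix: the surplus 3p of
      x_5^p over x_3^p combines with 3i to 3j + 3.\<close>
    have "1 + 3 * i + (6 + 3 * j) * p = (3 + 3 * j) * p + (4 + 3 * j)"
    proof -
      have "3 * i + 3 * p = 3 * j + 3" using ip by simp
      then show ?thesis by (simp add: algebra_simps)
    qed
    then show ?thesis
      using obstr[of "expvec (3 * i) 0 p 1 0" "expvec 0 (1 + 3 * i) 0 0 p"] ip by auto
  qed
qed

text \<open>The monomials that carry the parameter \<open>t\<^sub>i\<close>.\<close>

definition marked :: "nat \<Rightarrow> nat \<Rightarrow> nat ^ 5 \<Rightarrow> bool" where
  "marked j i u \<longleftrightarrow> i < j \<and> u $ 1 \<le> 1 \<and> u $ 2 = 3 + 3 * i \<and> u $ 3 = 0 \<and> u $ 5 = j - i"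

lemma marked_unique: "marked j i u \<Longrightarrow> marked j i' u \<Longrightarrow> i = i'"
  by (simp add: marked_def)

text \<open>The exponents of x_2 and x_5 in \<open>u\<close> are lower bounds for those in
  \<open>\<gamma> + u\<close>. The obstruction for \<open>i\<close> then caps x_5 at
  \<open>j - i\<close>, and the one for \<open>Suc i\<close> caps x_2 at \<open>3 + 3 * i\<close>.
  As both are positive, x_3 is excluded and x_1 occurs at most once.\<close>

lemma marked_add:
  assumes u: "marked j i u" and red: "reduced j (\<gamma> + u)"
  shows "marked j i (\<gamma> + u)"
proof -
  note o = reduced_obstructions[OF red]
  have "i + (j + 1 - i) = j + 1" "Suc i + (j - i) = j + 1"
    using u by (auto simp: marked_def)
  from o(5)[OF this(1)] o(5)[OF this(2)] o(1,2) show ?thesis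
    using u by (auto simp: marked_def)
qed

text \<open>A second reduced monomial in the degree of a marked one must contain x_3, and then
  neither x_2 nor x_5. The common factor \<open>\<gamma>\<close> is therefore free of x_2, x_3 and
  x_5, so \<open>u\<close> has the same exponents there as \<open>\<gamma> + u\<close>.\<close>

lemma marked_summand:
  assumes deg: "adeg (A_mat j) u = adeg (A_mat j) v" and "u \<noteq> v"
    and red: "reduced j (\<gamma> + u)" "reduced j (\<gamma> + v)" and mark: "marked j i (\<gamma> + u)"
  shows "marked j i u"
proof -
  let ?u = "\<gamma> + u" and ?v = "\<gamma> + v"
  have deg': "adeg (A_mat j) ?v = adeg (A_mat j) ?u" using deg by (simp add: adeg_add)
  have eq4: "?v $ 4 = ?u $ 4" using reduced_same_degree[OF red(1) deg'] red(2) by blast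
  have neq: "?v \<noteq> ?u" using \<open>u \<noteq> v\<close> by simp
  note o = reduced_obstructions[OF red(2)]
  have m: "i < j" "?u $ 1 \<le> 1" "?u $ 2 = 3 + 3 * i" "?u $ 3 = 0" "?u $ 5 = j - i"
    using mark by (simp_all only: marked_def)
  have tot: "?v$1 + ?v$2 + ?v$3 + ?v$5 = ?u$1 + ?u$2 + ?u$3 + ?u$5"
    and wt: "?v$2 + (3 + 3 * j) * ?v$3 + (6 + 3 * j) * ?v$5 = ?u$2 + (6 + 3 * j) * ?u$5"
    using deg' eq4 m(4) by (simp_all only: adeg_eq_iff) simp_all
  \<comment> \<open>With \<open>p = 0\<close> the alternative on x_5 is impossible.\<close>
  have "?v $ 2 \<le> 3 + 3 * j"
    using o(5)[of "j + 1" 0] by simp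
  have no_x3: "?v $ 3 \<noteq> 0"
  proof
    assume v3: "?v $ 3 = 0"
    \<comment> \<open>Without x_3, the weights are x_2-exponents plus multiples of
      \<open>6 + 3 * j\<close>. Both x_2-exponents are smaller than this modulus, so the multiples
      agree.\<close>
    have "?v $ 5 = ?u $ 5"
    proof (rule ccontr)
      assume "?v $ 5 \<noteq> ?u $ 5"
      then consider "Suc (?v $ 5) \<le> ?u $ 5" | "Suc (?u $ 5) \<le> ?v $ 5" by linarith
      then show False
      proof cases
        case 1
        then have "(6 + 3 * j) * Suc (?v $ 5) \<le> (6 + 3 * j) * ?u $ 5" by (rule mult_le_mono2)
        then show False using wt v3 \<open>?v $ 2 \<le> 3 + 3 * j\<close> by simp
      next
        case 2
        then have "(6 + 3 * j) * Suc (?u $ 5) \<le> (6 + 3 * j) * ?v $ 5" by (rule mult_le_mono2)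
        then show False using wt v3 m(1,3) by simp
      qed
    qed
    then have "?v = ?u"
      using wt tot v3 m(4) eq4 by (simp add: Finite_Cartesian_Product.vec_eq_iff all_5)
    then show False using neq by simp
  qed
  have v2: "?v $ 2 = 0" using o(1) no_x3 by auto
  have v5: "?v $ 5 = 0"
  proof (rule ccontr)
    assume "?v $ 5 \<noteq> 0"
    \<comment> \<open>Now only x_5 can make up the total degree, so its exponent exceeds that of
      \<open>?u\<close>, and the weight becomes too large.\<close>
    then have v: "?v $ 3 = 1" "?v $ 1 = 0" using o(3,4) no_x3 by linarith+
    have "?v $ 5 > ?u $ 5" using tot v v2 m by linarith
    then have "(6 + 3 * j) * Suc (?u $ 5) \<le> (6 + 3 * j) * ?v $ 5" by (intro mult_le_mono2) simp
    then show False using wt v v2 m(1,3) by simp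
  qed
  have "\<gamma> $ 2 = 0" "\<gamma> $ 5 = 0" "\<gamma> $ 3 = 0" "u $ 1 \<le> 1"
    using v2 v5 m(2,4) by simp_all
  then show ?thesis using mark by (simp add: marked_def)
qed

lemma marked_add_iff:
  assumes "adeg (A_mat j) u = adeg (A_mat j) v" "u \<noteq> v"
    and "reduced j (\<gamma> + u)" "reduced j (\<gamma> + v)"
  shows "marked j i (\<gamma> + u) \<longleftrightarrow> marked j i u"
  using assms marked_add marked_summand by blast

text \<open>
  The terms of the Graver binomial that makes the parameter \<open>t\<^sub>n\<close> visible; only \<open>flipU\<close> is marked.
\<close>

definition flipU :: "nat \<Rightarrow> nat \<Rightarrow> nat ^ 5" where
  "flipU j n = expvec 0 (3 + 3 * n) 0 0 (j - n)"

definition flipV :: "nat \<Rightarrow> nat \<Rightarrow> nat ^ 5" where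
  "flipV j n = expvec (2 + 3 * n) 0 (j + 1 - n) 0 0"

lemma adeg_flip:
  assumes "n < j"
  shows "adeg (A_mat j) (flipU j n) = adeg (A_mat j) (flipV j n)"
proof -
  obtain p where p: "j = n + p" using assms less_imp_add_positive by blast
  show ?thesis by (simp add: adeg_eq_iff flipU_def flipV_def p algebra_simps)
qed

text \<open>No monomial of this degree contains x_4, by comparing total degree and weight.\<close>

lemma reduced_flipV:
  assumes "n < j"
  shows "reduced j (flipV j n)"
  unfolding reduced_def
proof (intro allI impI)
  fix w assume w: "adeg (A_mat j) w = adeg (A_mat j) (flipV j n)"
  \<comment> \<open>\<open>Q\<close> is the x_3-exponent of \<open>flipV\<close>, and
    \<open>s = Q - r\<close> below counts the factors traded for x_1 or x_2.\<close>
  define Q r where "Q = j + 1 - n" and "r = w$3 + w$4 + w$5"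
  have tot: "w$1 + w$2 + r = 2 + 3 * n + Q"
    and wt: "(3 + 3 * j) * r + w$2 + w$4 + 3 * w$5 = (3 + 3 * j) * Q"
    using w by (simp_all add: adeg_eq_iff flipV_def Q_def r_def algebra_simps)
  have rQ: "r \<le> Q"
  proof -
    have "(3 + 3 * j) * r \<le> (3 + 3 * j) * Q" using wt by linarith
    then show ?thesis by simp
  qed
  then obtain s where s: "Q = r + s" using le_Suc_ex by blast
  have wt': "w$2 + w$4 + 3 * w$5 = (3 + 3 * j) * s"
    using wt by (simp add: s distrib_left)
  have "w $ 4 = 0"
  proof (cases "s = 0")
    case True
    then show ?thesis using wt' by simp
  next
    case False
    then have "3 + 3 * j \<le> (3 + 3 * j) * s" by simp
    then have "3 + 3 * j \<le> w$2 + w$4 + 3 * w$5" using wt' by simp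
    \<comment> \<open>From w_2 \<le> 2 + 3n + s and w_4 + w_5 \<le> r, the left side w_2 + w_4 + 3
      w_5 is at most 5 + 3j - 2s - 2 w_4. For s \<ge> 1 the lower bound 3 + 3j leaves only w_4 =
      0.\<close>
    moreover have "Q + n = j + 1" using assms by (simp add: Q_def)
    ultimately show ?thesis using tot s False r_def by linarith
  qed
  then show "w $ 4 \<le> flipV j n $ 4" by simp
qed

lemma reduced_flipU: "n < j \<Longrightarrow> reduced j (flipU j n)"
  using reduced_same_degree[OF reduced_flipV adeg_flip] by (simp add: flipU_def flipV_def)

lemma marked_flipU: "n < j \<Longrightarrow> marked j n (flipU j n)"
  by (simp add: marked_def flipU_def)

lemma not_marked_flipV: "n < j \<Longrightarrow> \<not> marked j i (flipV j n)"
  by (simp add: marked_def flipV_def)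

text \<open>For a smaller pair, the weights force \<open>v\<close> to have fewer factors x_5 than
  \<open>u\<close> has x_3. Closing the gap needs \<open>v$2 + 3 * v$5\<close> to be at least
  \<open>3 + 3 * j\<close>, which is its value at \<open>flipU\<close> and its maximum below it, so
  \<open>v\<close> is not smaller.\<close>

lemma graver_degree_flip:
  assumes "n < j"
  shows "adeg (A_mat j) (flipV j n) \<in> graver_degrees (A_mat j)"
proof -
  have "graver_binomial (A_mat j) (flipV j n) (flipU j n)"
    unfolding graver_binomial_def
  proof (intro conjI notI)
    assume "flipV j n = flipU j n"
    then have "flipV j n $ 1 = flipU j n $ 1" by simp
    then show False by (simp add: flipU_def flipV_def)
  next
    assume "\<exists>u v. u \<noteq> 0 \<and> v \<noteq> 0 \<and> adeg (A_mat j) u = adeg (A_mat j) v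
      \<and> u < flipV j n \<and> v < flipU j n"
    then obtain u v where "v \<noteq> 0" and deg: "adeg (A_mat j) u = adeg (A_mat j) v"
      and u: "u < flipV j n" and v: "v < flipU j n" by blast
    have le: "u$2 = 0" "u$4 = 0" "u$5 = 0" "v$1 = 0" "v$2 \<le> 3 + 3 * n" "v$3 = 0" "v$4 = 0" "v$5 \<le> j - n"
      using less_imp_le[OF u] less_imp_le[OF v]
      by (auto simp: Finite_Cartesian_Product.less_eq_vec_def all_5 flipU_def flipV_def)
    have wt: "(3 + 3 * j) * u$3 = v$2 + 3 * v$5 + (3 + 3 * j) * v$5"
      using deg le by (simp add: adeg_eq_iff algebra_simps)
    have "v$2 \<noteq> 0 \<or> v$5 \<noteq> 0"
      using \<open>v \<noteq> 0\<close> le by (auto simp: Finite_Cartesian_Product.vec_eq_iff all_5)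
    then have "(3 + 3 * j) * v$5 < (3 + 3 * j) * u$3" using wt by linarith
    then have "Suc (v$5) \<le> u$3" by simp
    then have "(3 + 3 * j) * Suc (v$5) \<le> (3 + 3 * j) * u$3" by (rule mult_le_mono2)
    then have "3 + 3 * j \<le> v$2 + 3 * v$5" using wt by simp
    then have "v$2 = 3 + 3 * n" "v$5 = j - n" using le(5,8) assms by linarith+
    then have "v = flipU j n"
      using le by (simp add: Finite_Cartesian_Product.vec_eq_iff all_5 flipU_def)
    then show False using v by simp
  qed (use adeg_flip[OF assms] in simp)
  then show ?thesis unfolding graver_degrees_def by blast
qed

section \<open>The family of evaluation homomorphisms\<close>

text \<open>
  The target is the polynomial ring in variables indexed by natural numbers: the even ones are the
  parameters \<open>t\<^sub>i\<close>, the odd ones are homogenizing variables, one for each degree. They make the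
  kernel multihomogeneous.
\<close>

definition deg_code :: "int ^ 2 \<Rightarrow> nat" where
  "deg_code b = 2 * to_nat (b $ 1, b $ 2) + 1"

lemma deg_code_eq_iff: "deg_code b = deg_code b' \<longleftrightarrow> b = b'"
  by (auto simp: deg_code_def Finite_Cartesian_Product.vec_eq_iff forall_2)

text \<open>The sum has at most one term. The parameters \<open>t\<^sub>i\<close> with \<open>i < n\<close> are specialized to \<open>1\<close>.\<close>

definition param_exp :: "nat \<Rightarrow> nat \<Rightarrow> nat ^ 5 \<Rightarrow> nat \<Rightarrow>\<^sub>0 nat" where
  "param_exp j n u = (\<Sum>i | n \<le> i \<and> marked j i u. Poly_Mapping.single (2 * i) 1)"

lemma param_exp_marked:
  assumes "marked j i u"
  shows "param_exp j n u = (if n \<le> i then Poly_Mapping.single (2 * i) 1 else 0)"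
proof -
  have "{i'. n \<le> i' \<and> marked j i' u} = (if n \<le> i then {i} else {})"
    using assms marked_unique by auto
  then show ?thesis by (simp add: param_exp_def)
qed

lemma param_exp_unmarked: "(\<And>i. \<not> marked j i u) \<Longrightarrow> param_exp j n u = 0"
  by (simp add: param_exp_def)

lemma param_exp_cong:
  "(\<And>i. marked j i u \<longleftrightarrow> marked j i v) \<Longrightarrow> param_exp j n u = param_exp j n v"
  by (simp add: param_exp_def)

text \<open>The coefficient a(u) of the family times the homogenizing variable of the degree of
  \<open>u\<close>.\<close>

definition family_coeff :: "nat \<Rightarrow> nat \<Rightarrow> nat ^ 5 \<Rightarrow> (nat \<Rightarrow>\<^sub>0 nat) \<Rightarrow>\<^sub>0 'k::field" where
  "family_coeff j n u =
     (if reduced j u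
      then Poly_Mapping.single (Poly_Mapping.single (deg_code (adeg (A_mat j) u)) 1 + param_exp j n u) 1
      else 0)"

text \<open>Either both sides vanish or all four monomials are reduced. In the latter case adding
  \<open>\<gamma>\<close> does not change the marking, so both sides carry the parameters of
  \<open>\<alpha>\<close> and \<open>\<beta>\<close> and the same homogenizing variables.\<close>

lemma family_coeff_relation:
  assumes deg: "adeg (A_mat j) \<alpha> = adeg (A_mat j) \<beta>"
  shows "family_coeff j n (\<gamma> + \<beta>) * family_coeff j n \<alpha>
    = (family_coeff j n (\<gamma> + \<alpha>) * family_coeff j n \<beta> :: _ \<Rightarrow>\<^sub>0 'k::field)"
proof (cases "\<alpha> = \<beta>")
  case False
  have deg': "adeg (A_mat j) (\<gamma> + \<alpha>) = adeg (A_mat j) (\<gamma> + \<beta>)"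
    using deg by (simp add: adeg_add)
  have transfer: "reduced j (\<gamma> + v)"
    if "reduced j (\<gamma> + u)" "reduced j v" "adeg (A_mat j) u = adeg (A_mat j) v" for u v
  proof -
    have "v $ 4 = u $ 4"
      using that reduced_summand reduced_same_degree by metis
    moreover have "adeg (A_mat j) (\<gamma> + v) = adeg (A_mat j) (\<gamma> + u)"
      using that(3) by (simp add: adeg_add)
    ultimately show ?thesis using reduced_same_degree[OF that(1)] by simp
  qed
  have iff: "reduced j (\<gamma> + \<beta>) \<and> reduced j \<alpha> \<longleftrightarrow> reduced j (\<gamma> + \<alpha>) \<and> reduced j \<beta>"
    using transfer[of \<alpha> \<beta>] transfer[of \<beta> \<alpha>] reduced_summand deg by metis
  show ?thesis
  proof (cases "reduced j (\<gamma> + \<beta>) \<and> reduced j \<alpha>")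
    case True
    then have red: "reduced j \<alpha>" "reduced j \<beta>" "reduced j (\<gamma> + \<alpha>)" "reduced j (\<gamma> + \<beta>)"
      using iff by auto
    have "param_exp j n (\<gamma> + \<alpha>) = param_exp j n \<alpha>"
      using marked_add_iff[OF deg False red(3,4)] by (rule param_exp_cong)
    moreover have "param_exp j n (\<gamma> + \<beta>) = param_exp j n \<beta>"
      using marked_add_iff[OF deg[symmetric] False[symmetric] red(4,3)] by (rule param_exp_cong)
    ultimately show ?thesis
      using red deg deg' by (simp add: family_coeff_def mult_single ac_simps)
  next
    case False
    then show ?thesis using iff by (auto simp: family_coeff_def)
  qed
qed simp

lemma family_coeff_degree:
  assumes "x \<in> Poly_Mapping.keys (family_coeff j n u :: _ \<Rightarrow>\<^sub>0 'k::field)"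
  shows "Poly_Mapping.lookup x (deg_code b) = (if adeg (A_mat j) u = b then 1 else 0)"
proof -
  have x: "x = Poly_Mapping.single (deg_code (adeg (A_mat j) u)) 1 + param_exp j n u"
    using assms by (auto simp: family_coeff_def split: if_splits)
  \<comment> \<open>Parity separates homogenizing variables from parameters.\<close>
  have odd: "deg_code b \<noteq> 2 * i" for i
    unfolding deg_code_def by presburger
  have "Poly_Mapping.lookup (param_exp j n u) (deg_code b) = 0"
    by (simp add: param_exp_def lookup_sum lookup_single odd[symmetric])
  then show ?thesis
    by (simp add: x lookup_add lookup_single when_def deg_code_eq_iff)
qed

lemma family_coeff_nonzero:
  "\<exists>u. adeg (A_mat j) u = adeg (A_mat j) w \<and> (family_coeff j n u :: _ \<Rightarrow>\<^sub>0 'k::field) \<noteq> 0"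
proof -
  obtain u where "adeg (A_mat j) u = adeg (A_mat j) w" "reduced j u"
    using reduced_exists by blast
  moreover have "Poly_Mapping.single m (1 :: 'k) \<noteq> 0" for m :: "nat \<Rightarrow>\<^sub>0 nat"
    by (metis insert_not_empty keys_single keys_zero zero_neq_one)
  ultimately show ?thesis by (intro exI[of _ u]) (simp add: family_coeff_def del: single_one)
qed

text \<open>The generic point of the closure of the subfamily on which t_0, ..., t_(n-1) equal 1;
  for \<open>n = j\<close> no parameter is left.\<close>

definition family_point :: "nat \<Rightarrow> nat \<Rightarrow> ((nat ^ 5 \<Rightarrow>\<^sub>0 nat) \<Rightarrow>\<^sub>0 'k::field) set" where
  "family_point j n = {f \<in> carrier (X_ring (A_mat j)). poly_subst (family_coeff j n) f = 0}"

lemma family_point_X_point: "family_point j n \<in> X_points (A_mat j)"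
  unfolding family_point_def
proof (rule poly_subst_kernel_X_point)
  show "Poly_Mapping.lookup x (deg_code b) = (if adeg (A_mat j) u = b then 1 else 0)"
    if "x \<in> Poly_Mapping.keys (family_coeff j n u :: _ \<Rightarrow>\<^sub>0 'a)" for u x b
    using that by (rule family_coeff_degree)
  show "\<exists>u. adeg (A_mat j) u = b \<and> (family_coeff j n u :: _ \<Rightarrow>\<^sub>0 'a) \<noteq> 0"
    if "b \<in> graver_degrees (A_mat j)" for b
    using that family_coeff_nonzero unfolding graver_degrees_def by blast
qed

lemma maximal_minors_family_point:
  assumes "b \<in> semigroup_NA (A_mat j)"
  shows "maximal_minors (A_mat j) b \<subseteq> family_point j n"
proof -
  obtain w where "b = adeg (A_mat j) w" using assms by (auto simp: semigroup_NA_def)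
  then obtain u where "adeg (A_mat j) u = b" "(family_coeff j n u :: _ \<Rightarrow>\<^sub>0 'a) \<noteq> 0"
    using family_coeff_nonzero by blast
  then show ?thesis
    unfolding family_point_def
    by (intro maximal_minors_poly_subst_kernel[OF family_coeff_relation])
qed

section \<open>Strict inclusions of kernels under specialization\<close>

lemma family_coeff_specialize:
  defines "d \<equiv> \<lambda>n v. if v = 2 * n then 1 else Poly_Mapping.single (Poly_Mapping.single v 1) 1"
  shows "poly_subst (d n) (family_coeff j n u)
    = (family_coeff j (Suc n) u :: (nat \<Rightarrow>\<^sub>0 nat) \<Rightarrow>\<^sub>0 'k::field)"
proof (cases "reduced j u")
  case True
  have odd: "deg_code b \<noteq> 2 * n" for b
    unfolding deg_code_def by presburger
  have "eval_monom (d n) (param_exp j n u)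
      = (Poly_Mapping.single (param_exp j (Suc n) u) 1 :: (nat \<Rightarrow>\<^sub>0 nat) \<Rightarrow>\<^sub>0 'k)"
  proof (cases "\<exists>i. marked j i u")
    case True
    then obtain i where "marked j i u" by blast
    then show ?thesis by (simp add: param_exp_marked d_def)
  qed (simp add: param_exp_unmarked)
  then show ?thesis
    using True by (simp add: family_coeff_def eval_monom_add odd d_def mult_single)
qed (simp add: family_coeff_def)

text \<open>Setting the variable \<open>2 * n\<close>, which is t_n, to 1 factors the substitution
  for \<open>Suc n\<close> through the one for \<open>n\<close>, so the kernel can only
  grow.\<close>

lemma family_point_Suc_subset:
  "family_point j n \<subseteq> (family_point j (Suc n) :: (_ \<Rightarrow>\<^sub>0 'k::field) set)"
proof
  fix f :: "(nat ^ 5 \<Rightarrow>\<^sub>0 nat) \<Rightarrow>\<^sub>0 'k" assume f: "f \<in> family_point j n"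
  define d :: "nat \<Rightarrow> (nat \<Rightarrow>\<^sub>0 nat) \<Rightarrow>\<^sub>0 'k"
    where "d = (\<lambda>v. if v = 2 * n then 1 else Poly_Mapping.single (Poly_Mapping.single v 1) 1)"
  have "poly_subst (family_coeff j (Suc n)) f = poly_subst d (poly_subst (family_coeff j n) f)"
    by (simp add: poly_subst_subst d_def family_coeff_specialize)
  then show "f \<in> family_point j (Suc n)" using f by (simp add: family_point_def)
qed

text \<open>The difference of the two flip variables is mapped to t_n - 1 times a homogenizing
  variable at stage \<open>n\<close>, and to 0 once t_n is 1.\<close>

lemma family_point_Suc_psubset:
  assumes "n < j"
  shows "family_point j n \<subset> (family_point j (Suc n) :: (_ \<Rightarrow>\<^sub>0 'k::field) set)"
proof -
  let ?f = "xi (flipU j n) - xi (flipV j n) :: (nat ^ 5 \<Rightarrow>\<^sub>0 nat) \<Rightarrow>\<^sub>0 'k"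
  let ?c = "\<lambda>m. family_coeff j m :: _ \<Rightarrow> _ \<Rightarrow>\<^sub>0 'k"
  interpret hom: comm_ring_hom "poly_subst (?c m)" for m by (rule poly_subst_hom)
  have graver: "adeg (A_mat j) (flipV j n) \<in> graver_degrees (A_mat j)"
      "adeg (A_mat j) (flipU j n) \<in> graver_degrees (A_mat j)"
    using graver_degree_flip[OF assms] by (simp_all add: adeg_flip[OF assms])
  have "?f \<in> carrier (X_ring (A_mat j))"
    using X_ring_closed(4)[OF xi_in_X_ring X_ring_closed(3)[OF xi_in_X_ring], OF graver(2,1)] by simp
  moreover have "poly_subst (?c m) ?f = ?c m (flipU j n) - ?c m (flipV j n)" for m
    by (simp add: hom.hom_minus)
  moreover have "?c (Suc n) (flipU j n) = ?c (Suc n) (flipV j n)"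
    using assms by (simp add: family_coeff_def reduced_flipU reduced_flipV adeg_flip
        param_exp_marked[OF marked_flipU] param_exp_unmarked[OF not_marked_flipV])
  moreover have "?c n (flipU j n) \<noteq> ?c n (flipV j n)"
  proof
    assume "?c n (flipU j n) = ?c n (flipV j n)"
    then have "Poly_Mapping.keys (?c n (flipU j n)) = Poly_Mapping.keys (?c n (flipV j n))" by simp
    then have "Poly_Mapping.single (2 * n) 1 = (0 :: nat \<Rightarrow>\<^sub>0 nat)"
      using assms by (simp add: family_coeff_def reduced_flipU reduced_flipV adeg_flip
          param_exp_marked[OF marked_flipU] param_exp_unmarked[OF not_marked_flipV])
    then have "Poly_Mapping.keys (Poly_Mapping.single (2 * n) (1 :: nat)) = {}" by (simp only: keys_zero)
    then show False by simp
  qed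
  ultimately have "?f \<in> family_point j (Suc n)" "?f \<notin> family_point j n"
    by (simp_all add: family_point_def)
  then show ?thesis using family_point_Suc_subset by blast
qed

theorem theorem4p1:
  fixes j :: nat and B :: "(int ^ 2) set"
  assumes "j \<noteq> 0"
    and "hilbert_test_degrees TYPE('k::field) (A_mat j) B"
  shows "\<exists>Z \<in> irreducible_components_of (toric_hilbert_scheme TYPE('k) (A_mat j) B).
           krull_dim (subtopology (toric_hilbert_scheme TYPE('k) (A_mat j) B) Z) \<ge> enat j"
proof -
  define H :: "((nat ^ 5 \<Rightarrow>\<^sub>0 nat) \<Rightarrow>\<^sub>0 'k) set set"
    where "H = {P \<in> X_points (A_mat j). \<forall>b \<in> B. maximal_minors (A_mat j) b \<subseteq> P}"
  have H: "toric_hilbert_scheme TYPE('k) (A_mat j) B = subtopology (X_zariski (A_mat j)) H"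
    by (simp add: toric_hilbert_scheme_def H_def)
  have B: "B \<subseteq> semigroup_NA (A_mat j)"
    using assms(2) by (simp add: hilbert_test_degrees_def)
  have P: "family_point j n \<in> H" for n
    using B by (auto simp: H_def family_point_X_point intro: maximal_minors_family_point[THEN subsetD])
  \<comment> \<open>Larger primes have smaller closures, so the index is reversed to obtain an
    ascending chain.\<close>
  define W where "W i = {Q \<in> H. family_point j (j - i) \<subseteq> Q}" for i
  show ?thesis
    unfolding H
  proof (rule component_krull_dim_ge)
    show "closedin (subtopology (X_zariski (A_mat j)) H) (W i)
        \<and> irreducible_in (subtopology (X_zariski (A_mat j)) H) (W i)" for i
      unfolding W_def by (intro conjI point_closure P) (auto simp: H_def)
    show "W i \<subset> W (Suc i)" if "i < j" for i
    proof -
      have "Suc (j - Suc i) = j - i" "j - Suc i < j" using that by auto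
      then have less: "family_point j (j - Suc i) \<subset> (family_point j (j - i) :: (_ \<Rightarrow>\<^sub>0 'k) set)"
        using family_point_Suc_psubset[of "j - Suc i" j] by simp
      \<comment> \<open>The generic point of \<open>W (Suc i)\<close> is a strictly smaller prime
        than that of \<open>W i\<close>, hence not in its closure.\<close>
      then have "family_point j (j - Suc i) \<in> W (Suc i) - W i"
        using P unfolding W_def by blast
      moreover have "W i \<subseteq> W (Suc i)" using less unfolding W_def by blast
      ultimately show ?thesis by blast
    qed
  qed
qed

end
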